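(* Let $(x_n)_{n=1}^{\infty}$ be a sequence on $[0,1]$, let $0 < \alpha < 1$ and assume that for all real $s > 0$ $$ \lim_{N \rightarrow \infty} \frac{1}{N^{2-\alpha}} \# \left\{ (m,n): 1 \leq m \neq n \leq N,\ |x_m - x_n| \leq \frac{s}{N^{\alpha}} \right\} = 2s.$$ Then the sequence $(x_n)_{n=1}^\infty$ is uniformly distributed on $[0,1]$.
   Context: The count is over ordered pairs $(m,n)$ with $m\ne n$. A sequence on $[0,1]$ is uniformly distributed if for every interval $J\subset[0,1]$, $\lim_{N\to\infty}\frac1N\#\{1\le i\le N: x_i\in J\}=|J|$, where $|J|$ is the length of $J$. *)

theory Defs
  imports "HOL-Analysis.Analysis"
begin

text \<open>Sequences are indexed from 1; the value at index 0 plays no role.\<close>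

text \<open>The predicate \<^const>\<open>is_interval\<close> covers open, closed, half-open and degenerate
  intervals; the length of such a \<open>J\<close> is its Lebesgue measure.\<close>

definition uniformly_distributed_01 :: "(nat \<Rightarrow> real) \<Rightarrow> bool" where
  "uniformly_distributed_01 x \<longleftrightarrow>
     (\<forall>J. is_interval J \<and> J \<subseteq> {0..1} \<longrightarrow>
        (\<lambda>N. real (card {i. 1 \<le> i \<and> i \<le> N \<and> x i \<in> J}) / real N)
          \<longlonglongrightarrow> measure lborel J)"

definition close_pairs :: "(nat \<Rightarrow> real) \<Rightarrow> nat \<Rightarrow> real \<Rightarrow> (nat \<times> nat) set" where
  "close_pairs x N r =
     {(m, n). m \<in> {1..N} \<and> n \<in> {1..N} \<and> m \<noteq> n \<and> \<bar>x m - x n\<bar> \<le> r}"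

end

theory Submission
  imports Defs
begin

text \<open>Let \<open>F t\<close> count the points \<open>x\<^sub>1, \<dots>, x\<^sub>N\<close> in the window \<open>[t, t + L]\<close>, where \<open>L = N powr - \<alpha>\<close>.
  The hypothesis, summed over several scales, bounds \<open>\<integral>F\<^sup>2\<close> asymptotically by \<open>(N L)\<^sup>2\<close>; the
  diagonal terms contribute only \<open>N L\<close>, which is negligible because \<open>\<alpha> < 1\<close>.
  Since \<open>\<integral>F = N L\<close> and \<open>F\<close> lives on \<open>[-L, 1]\<close>, the function \<open>F\<close> is almost constant in \<open>L\<^sup>2\<close>. Testing
  against a perturbation of the constant on \<open>[a - L, b]\<close> shows that no interval \<open>[a, b]\<close> contains more than
  its share of the points; the matching lower bound follows by passing to the complement.\<close>

section \<open>Second-moment inequality for window counts\<close>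

lemma measure_window_inter:
  fixes u v L :: real
  assumes "L \<ge> 0"
  shows "measure lborel ({u - L..u} \<inter> {v - L..v}) = max 0 (L - \<bar>u - v\<bar>)"
  using assms by (auto simp: max_def min_def abs_if)

text \<open>The integral of a square is nonnegative: apply this to the window count minus
  \<open>M\<close> times a step function equal to \<open>1 + d\<close> on \<open>[a - L, b]\<close>
  and to 1 on the rest of \<open>[- L, 1]\<close>. In the expansion the double sum is the integral
  of the squared count, and the cross term with the raised part brings in the points of
  \<open>[a, b]\<close>.\<close>

lemma window_second_moment_bound:
  fixes x :: "nat \<Rightarrow> real" and L a b d :: real
  assumes I: "finite I" "\<And>i. i \<in> I \<Longrightarrow> x i \<in> {0..1}"
    and L: "L > 0" and ab: "0 \<le> a" "a \<le> b" "b \<le> 1" and d: "d \<ge> 0"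
    and M: "M = real (card I) * L"
  shows "2 * M\<^sup>2 + 2 * d * M * L * real (card {i\<in>I. x i \<in> {a..b}})
    \<le> (\<Sum>i\<in>I. \<Sum>j\<in>I. max 0 (L - \<bar>x i - x j\<bar>))
       + M\<^sup>2 * (1 + L + (2 * d + d\<^sup>2) * (b - a + L))"
proof -
  \<comment> \<open>\<open>w i t\<close> is 1 exactly when \<open>x i\<close> lies in
    \<open>[t, t + L]\<close>, so the sum of the \<open>w i\<close> is the window count at
    \<open>t\<close>.\<close>
  define w where "w i = (indicator {x i - L..x i} :: real \<Rightarrow> real)" for i
  define g where "g = (indicator {- L..1} :: real \<Rightarrow> real)"
  define h where "h = (indicator {a - L..b} :: real \<Rightarrow> real)"
  define Q where "Q = (\<Sum>i\<in>I. \<Sum>j\<in>I. max 0 (L - \<bar>x i - x j\<bar>))"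
  define c where "c = card {i\<in>I. x i \<in> {a..b}}"
  have M0: "M \<ge> 0" using L M by simp
  have sq: "((\<Sum>i\<in>I. w i t) - M * g t - M * d * h t)\<^sup>2
      = (\<Sum>i\<in>I. \<Sum>j\<in>I. indicator ({x i - L..x i} \<inter> {x j - L..x j}) t)
        + M\<^sup>2 * g t + M\<^sup>2 * (2 * d + d\<^sup>2) * h t
        - 2 * M * (\<Sum>i\<in>I. w i t)
        - 2 * M * d * (\<Sum>i\<in>I. indicator ({x i - L..x i} \<inter> {a - L..b}) t)" for t
  proof -
    \<comment> \<open>The support of \<open>g\<close> contains those of every \<open>w i\<close> and
      of \<open>h\<close>, so multiplying by \<open>g\<close> changes nothing and the square
      collapses.\<close>
    have wg: "w i t * g t = w i t" if "i \<in> I" for i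
      using I(2)[OF that] L by (auto simp: w_def g_def indicator_def)
    have fg: "(\<Sum>i\<in>I. w i t) * g t = (\<Sum>i\<in>I. w i t)"
      by (simp add: sum_distrib_right wg)
    have gh: "g t * h t = h t" using ab L by (auto simp: g_def h_def indicator_def)
    have gg: "g t * g t = g t" and hh: "h t * h t = h t"
      by (auto simp: g_def h_def indicator_def)
    have ff: "(\<Sum>i\<in>I. w i t) * (\<Sum>i\<in>I. w i t)
        = (\<Sum>i\<in>I. \<Sum>j\<in>I. indicator ({x i - L..x i} \<inter> {x j - L..x j}) t)"
      by (simp add: sum_product w_def indicator_inter_arith del: Int_atLeastAtMost)
    have fh: "(\<Sum>i\<in>I. w i t) * h t
        = (\<Sum>i\<in>I. indicator ({x i - L..x i} \<inter> {a - L..b}) t)"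
      by (simp add: sum_distrib_right w_def h_def indicator_inter_arith del: Int_atLeastAtMost)
    have expand: "(u - M * v - M * d * z)\<^sup>2 = u * u + M\<^sup>2 * (v * v) + M\<^sup>2 * d\<^sup>2 * (z * z)
        - 2 * M * (u * v) - 2 * M * d * (u * z) + 2 * M\<^sup>2 * d * (v * z)" for u v z :: real
      by algebra
    show ?thesis unfolding ff[symmetric] fh[symmetric]
      unfolding expand fg gh gg hh by algebra
  qed
  have int: "integrable lborel (indicator ({u..v} \<inter> B) :: real \<Rightarrow> real)"
    if "B \<in> sets borel" for u v :: real and B
  proof -
    have "emeasure lborel ({u..v} \<inter> B) \<le> emeasure lborel {u..v}"
      using that by (intro emeasure_mono) auto
    also have "\<dots> < \<infinity>" by (simp add: emeasure_lborel_Icc_eq)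
    finally show ?thesis using that by (auto intro!: integrable_real_indicator)
  qed
  have intw: "integrable lborel (w i)" and intg: "integrable lborel g" and inth: "integrable lborel h" for i
    using int[of UNIV] by (auto simp: w_def g_def h_def)
  \<comment> \<open>A point of \<open>[a, b]\<close> has its whole window inside
    \<open>[a - L, b]\<close>; this is why \<open>h\<close> reaches \<open>L\<close> to the left of
    \<open>a\<close>.\<close>
  have len: "L * real c \<le> (\<Sum>i\<in>I. measure lborel ({x i - L..x i} \<inter> {a - L..b}))"
  proof -
    have "L * real c = (\<Sum>i\<in>{i\<in>I. x i \<in> {a..b}}. L)"
      by (simp add: c_def)
    also have "\<dots> = (\<Sum>i\<in>{i\<in>I. x i \<in> {a..b}}. measure lborel ({x i - L..x i} \<inter> {a - L..b}))"
    proof (rule sum.cong[OF refl])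
      fix i assume "i \<in> {i\<in>I. x i \<in> {a..b}}"
      then have "{x i - L..x i} \<inter> {a - L..b} = {x i - L..x i}" by auto
      then show "L = measure lborel ({x i - L..x i} \<inter> {a - L..b})" using L by simp
    qed
    also have "\<dots> \<le> (\<Sum>i\<in>I. measure lborel ({x i - L..x i} \<inter> {a - L..b}))"
      by (rule sum_mono2) (use I in auto)
    finally show ?thesis .
  qed
  have "0 \<le> integral\<^sup>L lborel (\<lambda>t. ((\<Sum>i\<in>I. w i t) - M * g t - M * d * h t)\<^sup>2)"
    by (rule integral_nonneg_AE) simp
  also have "\<dots> = Q + M\<^sup>2 * (1 + L) + M\<^sup>2 * (2 * d + d\<^sup>2) * (b - a + L) - 2 * M * (real (card I) * L)
      - 2 * M * d * (\<Sum>i\<in>I. measure lborel ({x i - L..x i} \<inter> {a - L..b}))"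
  proof -
    have 1: "integral\<^sup>L lborel (w i) = L" for i using L by (simp add: w_def)
    have 2: "integral\<^sup>L lborel g = 1 + L" using L by (simp add: g_def)
    have 3: "integral\<^sup>L lborel h = b - a + L" using L ab by (simp add: h_def)
    have 4: "integral\<^sup>L lborel (indicator ({u..v} \<inter> {p..q})) = measure lborel ({u..v} \<inter> {p..q})"
      for u v p q :: real by (simp del: Int_atLeastAtMost)
    show ?thesis unfolding sq Q_def
      by (simp add: int intw intg inth 1 2 3 4 measure_window_inter less_imp_le[OF L] del: Int_atLeastAtMost integral_indicator)
  qed
  also have "\<dots> \<le> Q + M\<^sup>2 * (1 + L) + M\<^sup>2 * (2 * d + d\<^sup>2) * (b - a + L) - 2 * M * M
      - 2 * M * d * (L * real c)"
    using mult_left_mono[OF len, of "2 * M * d"] M0 d M by simp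
  finally show ?thesis
    unfolding Q_def[symmetric] c_def[symmetric] by (simp add: algebra_simps power2_eq_square)
qed

section \<open>From pair counts to the second moment\<close>

text \<open>A staircase with \<open>K\<close> steps dominates the tent: after rescaling to
  \<open>y = r * K / L\<close>, at least \<open>K - y\<close> of the integers from 1 to
  \<open>K\<close> are \<open>\<ge> y\<close>.\<close>

lemma tent_le_step_sum:
  fixes L r :: real
  assumes L: "L > 0" and K: "K \<ge> 1" and r: "r \<ge> 0"
  shows "max 0 (L - r) \<le> L / real K * (\<Sum>k=1..K. of_bool (r \<le> real k / real K * L))"
proof (cases "r < L")
  case True
  define y where "y = r * real K / L"
  have y: "y \<ge> 0" "y < real K" using assms True by (auto simp: y_def field_simps)
  have eq: "{k\<in>{1..K}. r \<le> real k / real K * L} = {k\<in>{1..K}. y \<le> real k}"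
    using L K by (auto simp: y_def field_simps)
  \<comment> \<open>The \<open>max 1\<close> covers \<open>y = 0\<close>, where the ceiling is 0 but
    the steps start at 1.\<close>
  have sub: "{max 1 (nat \<lceil>y\<rceil>)..K} \<subseteq> {k\<in>{1..K}. y \<le> real k}"
    by (auto simp: nat_le_iff ceiling_le_iff)
  have "real K - y \<le> real (card {max 1 (nat \<lceil>y\<rceil>)..K})"
    using y by (auto simp: max_def; linarith)
  also have "\<dots> \<le> real (card {k\<in>{1..K}. y \<le> real k})"
    using sub by (intro of_nat_mono card_mono) auto
  also have "\<dots> = (\<Sum>k=1..K. of_bool (r \<le> real k / real K * L))"
    unfolding eq[symmetric] by (subst sum_of_bool_eq) (simp_all add: Int_def)
  finally have *: "real K - y \<le> (\<Sum>k=1..K. of_bool (r \<le> real k / real K * L))" .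
  have "max 0 (L - r) = L / real K * (real K - y)" using True L K by (simp add: y_def field_simps)
  also have "\<dots> \<le> L / real K * (\<Sum>k=1..K. of_bool (r \<le> real k / real K * L))"
    by (rule mult_left_mono[OF *]) (use L in auto)
  finally show ?thesis .
next
  case False
  then show ?thesis using L by (auto intro!: mult_nonneg_nonneg sum_nonneg divide_nonneg_nonneg)
qed

text \<open>The diagonal, absent from \<open>close_pairs\<close>, costs exactly \<open>L\<close> per
  index; off the diagonal the staircase bound turns into pair counts at the scales
  \<open>k / K * L\<close>.\<close>

lemma sum_tent_le_close_pairs:
  fixes x :: "nat \<Rightarrow> real"
  assumes L: "L > 0" and K: "K \<ge> 1"
  shows "(\<Sum>i\<in>{1..N}. \<Sum>j\<in>{1..N}. max 0 (L - \<bar>x i - x j\<bar>))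
    \<le> real N * L + L / real K * (\<Sum>k=1..K. real (card (close_pairs x N (real k / real K * L))))"
proof -
  define T where "T i j = (\<Sum>k=1..K. of_bool (i \<noteq> j \<and> \<bar>x i - x j\<bar> \<le> real k / real K * L) :: real)"
    for i j
  have "(\<Sum>i\<in>{1..N}. \<Sum>j\<in>{1..N}. max 0 (L - \<bar>x i - x j\<bar>))
      \<le> (\<Sum>i\<in>{1..N}. \<Sum>j\<in>{1..N}. (if i = j then L else 0) + L / real K * T i j)"
  proof (intro sum_mono)
    fix i j
    show "max 0 (L - \<bar>x i - x j\<bar>) \<le> (if i = j then L else 0) + L / real K * T i j"
      using tent_le_step_sum[OF L K, of "\<bar>x i - x j\<bar>"] L by (cases "i = j") (auto simp: T_def)
  qed
  also have "\<dots> = real N * L + L / real K * (\<Sum>i\<in>{1..N}. \<Sum>j\<in>{1..N}. T i j)"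
    by (simp add: sum.distrib sum_distrib_left)
  also have "(\<Sum>i\<in>{1..N}. \<Sum>j\<in>{1..N}. T i j)
      = (\<Sum>k=1..K. \<Sum>i\<in>{1..N}. \<Sum>j\<in>{1..N}. of_bool (i \<noteq> j \<and> \<bar>x i - x j\<bar> \<le> real k / real K * L))"
    unfolding T_def by (simp only: sum.swap[where A = "{1..N}" and B = "{1..K}"])
  also have "\<dots> = (\<Sum>k=1..K. real (card (close_pairs x N (real k / real K * L))))"
  proof (rule sum.cong[OF refl])
    fix k
    have "{1..N} \<times> {1..N} \<inter> {p. fst p \<noteq> snd p \<and> \<bar>x (fst p) - x (snd p)\<bar> \<le> real k / real K * L}
        = close_pairs x N (real k / real K * L)"
      by (auto simp: close_pairs_def)
    then show "(\<Sum>i\<in>{1..N}. \<Sum>j\<in>{1..N}. of_bool (i \<noteq> j \<and> \<bar>x i - x j\<bar> \<le> real k / real K * L))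
        = real (card (close_pairs x N (real k / real K * L)))"
      unfolding sum.cartesian_product case_prod_beta
      by (subst sum_of_bool_eq) simp_all
  qed
  finally show ?thesis .
qed

section \<open>Asymptotic upper bound for closed intervals\<close>

text \<open>The second-moment bound is used with \<open>d = e\<close>: the gain is linear in
  \<open>e\<close>, while the quadratic loss and the staircase error are absorbed by the slack
  \<open>e\<close> in the conclusion.\<close>

lemma eventually_proportion_less:
  fixes x :: "nat \<Rightarrow> real" and \<alpha> a b e :: real
  assumes x: "\<And>n. n \<ge> 1 \<Longrightarrow> x n \<in> {0..1}"
    and \<alpha>: "0 < \<alpha>" "\<alpha> < 1"
    and lim: "\<And>s::real. s > 0 \<Longrightarrow>
      (\<lambda>N. 1 / real N powr (2 - \<alpha>) * real (card (close_pairs x N (s / real N powr \<alpha>))))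
        \<longlonglongrightarrow> 2 * s"
    and ab: "0 \<le> a" "a \<le> b" "b \<le> 1" and e: "e > 0"
  shows "eventually (\<lambda>N. real (card {i\<in>{1..N}. x i \<in> {a..b}}) / real N < b - a + e) sequentially"
proof -
  obtain K :: nat where K: "real K > 2 / e\<^sup>2" using reals_Archimedean2 by blast
  then have K1: "K \<ge> 1" using e by (cases K) (auto simp: field_simps dest: order.strict_trans2)
  define P where "P N k = 1 / real N powr (2 - \<alpha>)
    * real (card (close_pairs x N (real k / real K / real N powr \<alpha>)))" for N k
  \<comment> \<open>This is the upper bound for the second-moment inequality divided by
    \<open>M\<^sup>2\<close>; its first term is \<open>1 / M\<close>, the diagonal contribution,
    which vanishes because \<alpha> < 1.\<close>
  define B where "B N = real N powr (\<alpha> - 1) + 1 / real K * (\<Sum>k=1..K. P N k)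
    + (1 + real N powr - \<alpha> + (2 * e + e\<^sup>2) * (b - a + real N powr - \<alpha>))" for N
  have "B \<longlonglongrightarrow> 0 + 1 / real K * (\<Sum>k=1..K. 2 * (real k / real K))
      + (1 + 0 + (2 * e + e\<^sup>2) * (b - a + 0))"
    unfolding B_def
  proof (intro tendsto_intros)
    show "(\<lambda>N. real N powr (\<alpha> - 1)) \<longlonglongrightarrow> 0" "(\<lambda>N. real N powr - \<alpha>) \<longlonglongrightarrow> 0"
      using \<alpha> by (auto intro!: tendsto_neg_powr filterlim_real_sequentially)
    \<comment> \<open>This term occurs twice in \<open>B\<close>, so its limit is required
      twice.\<close>
    then show "(\<lambda>N. real N powr - \<alpha>) \<longlonglongrightarrow> 0" by simp
    fix k assume "k \<in> {1..K}"
    then show "(\<lambda>N. P N k) \<longlonglongrightarrow> 2 * (real k / real K)"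
      unfolding P_def using K1 by (intro lim) auto
  qed
  also have "(\<Sum>k=1..K. 2 * (real k / real K)) = real K + 1"
  proof -
    have "(\<Sum>k=1..K. real k) = real K * (real K + 1) / 2"
      by (induction K) (auto simp: field_simps)
    then have "2 / real K * (\<Sum>k=1..K. real k) = real K + 1" using K1 by (simp add: field_simps)
    then show ?thesis by (simp add: sum_distrib_left)
  qed
  \<comment> \<open>The staircase exceeds the ideal value 1 by \<open>1 / K\<close>. The main term 2
    will cancel against \<open>2 * M\<^sup>2\<close> on the left of the moment inequality.\<close>
  also have "0 + 1 / real K * (real K + 1) + (1 + 0 + (2 * e + e\<^sup>2) * (b - a + 0))
      = 2 + 1 / real K + (2 * e + e\<^sup>2) * (b - a)"
    using K1 by (simp add: field_simps)
  finally have Blim: "B \<longlonglongrightarrow> 2 + 1 / real K + (2 * e + e\<^sup>2) * (b - a)" .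
  \<comment> \<open>The choice of \<open>K\<close> makes the total error at most
    \<open>e\<^sup>2 / 2 + e\<^sup>2\<close>, below the available
    \<open>2 * e\<^sup>2\<close>.\<close>
  have "1 / real K < e\<^sup>2 / 2" using K K1 e by (simp add: field_simps)
  moreover have "e\<^sup>2 * (b - a) \<le> e\<^sup>2" using ab by (intro mult_left_le) auto
  moreover have "e\<^sup>2 > 0" using e by simp
  ultimately have "2 + 1 / real K + (2 * e + e\<^sup>2) * (b - a) < 2 + 2 * e * (b - a + e)"
    by (simp add: algebra_simps power2_eq_square)
  from order_tendstoD(2)[OF Blim this] eventually_gt_at_top[of 0]
  show ?thesis
  proof eventually_elim
    case (elim N)
    define L where "L = real N powr - \<alpha>"
    define M where "M = real N * L"
    define c where "c = real (card {i\<in>{1..N}. x i \<in> {a..b}})"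
    have L: "L > 0" and M: "M > 0" using elim by (auto simp: L_def M_def)
    have cp: "1 / real N powr (2 - \<alpha>) = L / M\<^sup>2" "1 / M = real N powr (\<alpha> - 1)"
      using elim by (auto simp: L_def M_def powr_diff powr_minus power2_eq_square field_simps)
    have P: "P N k = L / M\<^sup>2 * real (card (close_pairs x N (real k / real K * L)))" for k
      unfolding P_def cp by (simp add: L_def powr_minus_divide)
    have "2 * M\<^sup>2 + 2 * e * M * L * c
        \<le> (\<Sum>i\<in>{1..N}. \<Sum>j\<in>{1..N}. max 0 (L - \<bar>x i - x j\<bar>))
          + M\<^sup>2 * (1 + L + (2 * e + e\<^sup>2) * (b - a + L))"
      unfolding c_def using x L ab e by (intro window_second_moment_bound) (auto simp: M_def)
    also have "\<dots> \<le> M + L / real K * (\<Sum>k=1..K. real (card (close_pairs x N (real k / real K * L))))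
        + M\<^sup>2 * (1 + L + (2 * e + e\<^sup>2) * (b - a + L))"
      unfolding M_def using sum_tent_le_close_pairs[OF L K1, where N = N and x = x] by simp
    also have "\<dots> = M\<^sup>2 * B N"
    proof -
      have "M\<^sup>2 * real N powr (\<alpha> - 1) = M"
        using M by (simp add: cp(2)[symmetric] power2_eq_square)
      moreover have "M\<^sup>2 * (1 / real K * (\<Sum>k=1..K. P N k))
          = L / real K * (\<Sum>k=1..K. real (card (close_pairs x N (real k / real K * L))))"
        unfolding P sum_distrib_left[symmetric] using M by simp
      ultimately show ?thesis unfolding B_def L_def[symmetric] by (simp only: distrib_left)
    qed
    also have "\<dots> < M\<^sup>2 * (2 + 2 * e * (b - a + e))" using elim M by simp
    finally have "2 * e * M * L * c < 2 * e * M * M * (b - a + e)"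
      by (simp add: algebra_simps power2_eq_square)
    then have "(2 * e * M * L) * c < (2 * e * M * L) * (real N * (b - a + e))"
      by (simp add: M_def mult_ac)
    then have "c < real N * (b - a + e)"
      by (rule mult_less_cancel_left_pos[THEN iffD1, rotated]) (use e M L in simp)
    then show ?case using elim by (simp add: c_def field_simps)
  qed
qed

section \<open>General intervals and uniform distribution\<close>

text \<open>Taking \<open>Inf J\<close> and \<open>Sup J\<close> as endpoints treats open, closed,
  half-open and one-point intervals alike.\<close>

lemma bounded_interval_endpoints:
  fixes J :: "real set"
  assumes J: "is_interval J" "J \<noteq> {}" "J \<subseteq> {u..v}"
  obtains a b where "u \<le> a" "a \<le> b" "b \<le> v" "{a<..<b} \<subseteq> J" "J \<subseteq> {a..b}"
proof
  have bd: "bdd_below J" "bdd_above J" using J(3) by (auto intro: bdd_below_mono bdd_above_mono)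
  show "u \<le> Inf J" "Sup J \<le> v" using J(3) by (auto intro!: cInf_greatest[OF J(2)] cSup_least[OF J(2)])
  show "Inf J \<le> Sup J" using bd J by (intro cInf_le_cSup)
  show "J \<subseteq> {Inf J..Sup J}" using bd by (auto intro: cInf_lower cSup_upper)
  show "{Inf J<..<Sup J} \<subseteq> J"
  proof
    fix t assume "t \<in> {Inf J<..<Sup J}"
    then obtain p q where "p \<in> J" "p < t" "q \<in> J" "t < q"
      using J(2) bd cInf_lessD[of J t] less_cSupD[of J t] by auto
    then show "t \<in> J" using J(1) unfolding is_interval_1 by (meson less_imp_le)
  qed
qed

lemma measure_eq_length:
  fixes J :: "real set"
  assumes "{a<..<b} \<subseteq> J" "J \<subseteq> {a..b}" "a \<le> b"
  shows "measure lborel J = b - a"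
proof -
  \<comment> \<open>\<open>J\<close> differs from an open interval by at most two points, hence is
    Borel.\<close>
  have "J = {a<..<b} \<union> (J \<inter> {a, b})" using assms by force
  moreover have "finite (J \<inter> {a, b})" by simp
  ultimately have "J \<in> sets borel"
    by (metis borel_open finite_imp_closed borel_closed open_greaterThanLessThan sets.Un)
  have ab: "{a..b} \<in> fmeasurable lborel"
    by (simp add: fmeasurable_def emeasure_lborel_Icc_eq)
  then have Jf: "J \<in> fmeasurable lborel"
    by (rule fmeasurableI2) (use assms \<open>J \<in> sets borel\<close> in auto)
  have "measure lborel {a<..<b} \<le> measure lborel J"
    by (rule measure_mono_fmeasurable[OF assms(1) _ Jf]) simp
  moreover have "measure lborel J \<le> measure lborel {a..b}"
    by (rule measure_mono_fmeasurable[OF assms(2) _ ab]) (use \<open>J \<in> sets borel\<close> in simp)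
  ultimately show ?thesis using assms(3) by simp
qed

theorem corollary4:
  fixes x :: "nat \<Rightarrow> real" and \<alpha> :: real
  assumes "\<And>n. n \<ge> 1 \<Longrightarrow> x n \<in> {0..1}"
    and "0 < \<alpha>" and "\<alpha> < 1"
    and "\<And>s::real. s > 0 \<Longrightarrow>
      (\<lambda>N. 1 / real N powr (2 - \<alpha>) * real (card (close_pairs x N (s / real N powr \<alpha>))))
        \<longlonglongrightarrow> 2 * s"
  shows "uniformly_distributed_01 x"
  unfolding uniformly_distributed_01_def
proof (intro allI impI, elim conjE)
  fix J :: "real set"
  assume J: "is_interval J" "J \<subseteq> {0..1}"
  show "(\<lambda>N. real (card {i. 1 \<le> i \<and> i \<le> N \<and> x i \<in> J}) / real N) \<longlonglongrightarrow> measure lborel J"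
  proof (cases "J = {}")
    case False
    obtain a b where ab: "0 \<le> a" "a \<le> b" "b \<le> 1" and sub: "{a<..<b} \<subseteq> J" "J \<subseteq> {a..b}"
      using bounded_interval_endpoints[OF J(1) False J(2)] by blast
    define c where "c A N = card {i\<in>{1..N}. x i \<in> A}" for A N
    have upper: "\<forall>\<^sub>F N in sequentially. real (c {p..q} N) / real N < q - p + e"
      if "0 \<le> p" "p \<le> q" "q \<le> 1" "e > 0" for p q e
      unfolding c_def using eventually_proportion_less[OF assms that] by simp
    have "(\<lambda>N. real (c J N) / real N) \<longlonglongrightarrow> b - a"
    proof (rule order_tendstoI)
      fix y assume "b - a < y"
      then have "\<forall>\<^sub>F N in sequentially. real (c {a..b} N) / real N < y"
        using upper[OF ab, of "y - (b - a)"] by simp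
      then show "\<forall>\<^sub>F N in sequentially. real (c J N) / real N < y"
      proof eventually_elim
        case (elim N)
        have "c J N \<le> c {a..b} N" unfolding c_def using sub by (intro card_mono) auto
        then have "real (c J N) / real N \<le> real (c {a..b} N) / real N"
          by (intro divide_right_mono) auto
        then show ?case using elim by simp
      qed
    next
      fix y assume y: "y < b - a"
      \<comment> \<open>Half the gap, since each of the two complementary intervals loses one
        \<open>e\<close>.\<close>
      define e where "e = (b - a - y) / 2"
      have e: "e > 0" using y by (simp add: e_def)
      have "\<forall>\<^sub>F N in sequentially. real (c {0..a} N) / real N < a - 0 + e"
        "\<forall>\<^sub>F N in sequentially. real (c {b..1} N) / real N < 1 - b + e"
        by (intro upper; use ab e in simp)+
      then show "\<forall>\<^sub>F N in sequentially. y < real (c J N) / real N"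
        using eventually_gt_at_top[of 0]
      proof eventually_elim
        case (elim N)
        \<comment> \<open>The closed intervals \<open>[0, a]\<close> and \<open>[b, 1]\<close> may
          overlap \<open>J\<close> at its endpoints; only a covering is needed for the lower
          bound.\<close>
        have "{1..N} \<subseteq> {i\<in>{1..N}. x i \<in> J} \<union> {i\<in>{1..N}. x i \<in> {0..a}} \<union> {i\<in>{1..N}. x i \<in> {b..1}}"
          using assms(1) sub by force
        then have "card {1..N} \<le> card ({i\<in>{1..N}. x i \<in> J} \<union> {i\<in>{1..N}. x i \<in> {0..a}} \<union> {i\<in>{1..N}. x i \<in> {b..1}})"
          by (intro card_mono) auto
        also have "\<dots> \<le> c J N + c {0..a} N + c {b..1} N"
          unfolding c_def by (meson add_le_mono1 card_Un_le order_trans)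
        finally have "real N \<le> real (c J N) + real (c {0..a} N) + real (c {b..1} N)"
          by (simp flip: of_nat_add)
        then have "1 \<le> real (c J N) / real N + real (c {0..a} N) / real N + real (c {b..1} N) / real N"
          using elim by (simp add: field_simps)
        then show ?case using elim by (simp add: e_def field_simps)
      qed
    qed
    moreover have "measure lborel J = b - a" using sub ab by (intro measure_eq_length)
    ultimately show ?thesis by (simp add: c_def conj_assoc)
  qed simp
qed

end
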